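(* Let $F_n^{(a)}(q)$ ($n\ge 0$) be the $q$-Fibonacci numbers with parameter $a$. For every integer $n\ge 0$ and every $t\ne 0$ such that $(t^{-1}q^{a+1};q)_n\neq 0$, $$\sum_{k=0}^n \frac{1}{t^k}\cdot \frac{ F^{(a)}_{k+2}(q) - t F^{(a)}_{k}(q)}{(t^{-1}q^{a+1};q)_{k}}= \frac{1}{t^n}\cdot \frac{F^{(a)}_{n+1}(q)}{(t^{-1}q^{a+1};q)_{n}}.$$
   Context: The $q$-Fibonacci numbers with parameter $a$ are defined by $F_0^{(a)}(q)=0$, $F_1^{(a)}(q)=1$, and $F_{n+2}^{(a)}(q) = F_{n+1}^{(a)}(q) + q^{a+n} F_n^{(a)}(q)$ for $n\ge 0$. The $q$-rising factorial is $(A;q)_0=1$ and $(A;q)_m=(1-A)(1-Aq)\cdots(1-Aq^{m-1})$ for $m\ge 1$. Here $q$ is a nonzero complex number (or an indeterminate), and $q^{a+m}$ means $q^a\cdot q^m$ for a fixed nonzero value $q^a$. $t$ is an indeterminate or a complex number. *)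

theory Defs
  imports Complex_Main
begin

(* The parameter a enters only through the value q^a, which is passed as the argument qa;
   q^(a+m) is then qa * q^m. *)
fun q_fibonacci :: "'a::comm_ring_1 \<Rightarrow> 'a \<Rightarrow> nat \<Rightarrow> 'a" where
  "q_fibonacci qa q 0 = 0"
| "q_fibonacci qa q (Suc 0) = 1"
| "q_fibonacci qa q (Suc (Suc n)) = q_fibonacci qa q (Suc n) + qa * q ^ n * q_fibonacci qa q n"

definition q_rising :: "'a::comm_ring_1 \<Rightarrow> 'a \<Rightarrow> nat \<Rightarrow> 'a" where
  "q_rising A q m = (\<Prod>i<m. 1 - A * q ^ i)"

end

theory Submission
  imports Defs
begin

text \<open>The sum telescopes. Write \<open>S n\<close> for the right-hand side and
  \<open>R\<close> for the rising factorial. Over the denominator \<open>t ^ n * R n\<close>, the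
  difference \<open>S n - S (n - 1)\<close> has numerator
  \<open>F (n + 1) - (t - qa * q ^ n) * F n\<close>, which the Fibonacci recurrence turns into
  \<open>F (n + 2) - t * F n\<close>, the summand at \<open>n\<close>.\<close>

theorem mainTheorem13:
  fixes q qa t :: "'a::field" and n :: nat
  assumes "q \<noteq> 0" and "qa \<noteq> 0" and "t \<noteq> 0"
    and "q_rising (inverse t * (qa * q)) q n \<noteq> 0"
  shows "(\<Sum>k=0..n. 1 / t ^ k *
            ((q_fibonacci qa q (k + 2) - t * q_fibonacci qa q k)
              / q_rising (inverse t * (qa * q)) q k))
         = 1 / t ^ n * (q_fibonacci qa q (n + 1) / q_rising (inverse t * (qa * q)) q n)"
  using assms(4)
proof (induction n)
  case 0
  show ?case by (simp add: q_rising_def)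
next
  case (Suc n)
  let ?F = "q_fibonacci qa q" and ?R = "q_rising (inverse t * (qa * q)) q"
  define c where "c = 1 - inverse t * (qa * q) * q ^ n"
  have R: "?R (Suc n) = ?R n * c"
    by (simp add: q_rising_def c_def)
  \<comment> \<open>A nonzero product has nonzero factors, so the induction hypothesis applies at
    \<open>n\<close>.\<close>
  with Suc.prems have nz: "?R n \<noteq> 0" "c \<noteq> 0"
    by auto
  have tc: "t * c = t - qa * q ^ Suc n"
    using \<open>t \<noteq> 0\<close> by (simp add: c_def field_simps)
  \<comment> \<open>The terms \<open>t * ?F (n + 1)\<close> cancel; what remains is the recurrence
    for \<open>?F (n + 3)\<close>, solved for \<open>?F (n + 2)\<close>.\<close>
  have F: "t * c * ?F (n + 1) + (?F (n + 3) - t * ?F (n + 1)) = ?F (n + 2)"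
    unfolding tc by (simp add: numeral_eq_Suc algebra_simps)
  have "(\<Sum>k=0..Suc n. 1 / t ^ k * ((?F (k + 2) - t * ?F k) / ?R k))
      = 1 / t ^ n * (?F (n + 1) / ?R n)
        + 1 / t ^ Suc n * ((?F (n + 3) - t * ?F (n + 1)) / (?R n * c))"
    using Suc.IH nz R by (simp add: numeral_eq_Suc)
  \<comment> \<open>Expanding the first fraction by \<open>t * c\<close> gives the common
    denominator.\<close>
  also have "\<dots> = (t * c * ?F (n + 1) + (?F (n + 3) - t * ?F (n + 1))) / (t ^ Suc n * (?R n * c))"
    using nz \<open>t \<noteq> 0\<close> by (simp add: add_divide_distrib)
  also have "\<dots> = 1 / t ^ Suc n * (?F (Suc n + 1) / ?R (Suc n))"
    unfolding F R by simp
  finally show ?case .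
qed

end
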